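(* Let $n\ge 1$, let $G_{1},G_{2},\ldots ,G_{n}$ be nontrivial finite cyclic groups and let $\Gamma =G_{1}\ast G_{2}\ast \cdots \ast G_{n}$ be their free product. Then $$d\left( \widetilde{\Gamma }\right) =d\left( \widehat{\Gamma }\right) =n,$$ where $\widetilde{\Gamma }$ denotes the prosolvable completion of $\Gamma$.
   Context: For a group $\Gamma$, $\widehat{\Gamma}$ denotes its profinite completion, and the prosolvable completion $\widetilde{\Gamma}$ is the inverse limit of all finite solvable quotients of $\Gamma$. For a profinite group $P$, $d(P)$ denotes the minimal number of topological generators of $P$, i.e. the smallest cardinality of a subset generating a dense subgroup of $P$. *)

theory Defs
  imports
    "HOL-Algebra.Product_Groups"
    "HOL-Algebra.Solvable_Groups"
    "HOL-Analysis.Function_Topology"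
    "HOL-Library.Extended_Nat"
begin

section \<open>Free products\<close>

text \<open>
  The free product of a family of groups is the monoid of words in the disjoint union of the
  factors, modulo the congruence generated by deleting identity letters and by multiplying
  adjacent letters from the same factor.
\<close>

definition free_product_words :: "'i set \<Rightarrow> ('i \<Rightarrow> ('a, 'b) monoid_scheme) \<Rightarrow> ('i \<times> 'a) list set"
  where "free_product_words I G = lists (SIGMA i:I. carrier (G i))"

inductive_set free_product_rel ::
  "'i set \<Rightarrow> ('i \<Rightarrow> ('a, 'b) monoid_scheme) \<Rightarrow> (('i \<times> 'a) list \<times> ('i \<times> 'a) list) set"
  for I :: "'i set" and G :: "'i \<Rightarrow> ('a, 'b) monoid_scheme"
  where
    refl: "w \<in> free_product_words I G \<Longrightarrow> (w, w) \<in> free_product_rel I G"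
  | sym: "(v, w) \<in> free_product_rel I G \<Longrightarrow> (w, v) \<in> free_product_rel I G"
  | trans: "(u, v) \<in> free_product_rel I G \<Longrightarrow> (v, w) \<in> free_product_rel I G
      \<Longrightarrow> (u, w) \<in> free_product_rel I G"
  | unit: "\<lbrakk> u \<in> free_product_words I G; v \<in> free_product_words I G; i \<in> I \<rbrakk>
      \<Longrightarrow> (u @ [(i, \<one>\<^bsub>G i\<^esub>)] @ v, u @ v) \<in> free_product_rel I G"
  | mult: "\<lbrakk> u \<in> free_product_words I G; v \<in> free_product_words I G; i \<in> I;
        x \<in> carrier (G i); y \<in> carrier (G i) \<rbrakk>
      \<Longrightarrow> (u @ [(i, x), (i, y)] @ v, u @ [(i, x \<otimes>\<^bsub>G i\<^esub> y)] @ v) \<in> free_product_rel I G"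

definition free_product :: "'i set \<Rightarrow> ('i \<Rightarrow> ('a, 'b) monoid_scheme) \<Rightarrow> ('i \<times> 'a) list set monoid"
  where "free_product I G =
    \<lparr> carrier = free_product_words I G // free_product_rel I G,
      monoid.mult = (\<lambda>A B. \<Union>u\<in>A. \<Union>v\<in>B. free_product_rel I G `` {u @ v}),
      one = free_product_rel I G `` {[]} \<rparr>"

definition free_product_inj ::
  "'i set \<Rightarrow> ('i \<Rightarrow> ('a, 'b) monoid_scheme) \<Rightarrow> 'i \<Rightarrow> 'a \<Rightarrow> ('i \<times> 'a) list set"
  where "free_product_inj I G i x = free_product_rel I G `` {[(i, x)]}"

context
  fixes I :: "'i set" and G :: "'i \<Rightarrow> ('a, 'b) monoid_scheme"
  assumes grp: "\<And>i. i \<in> I \<Longrightarrow> group (G i)"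
begin

private abbreviation "W \<equiv> free_product_words I G"
private abbreviation "R \<equiv> free_product_rel I G"

lemma free_product_words_append:
  "u @ v \<in> free_product_words I G \<longleftrightarrow> u \<in> free_product_words I G \<and> v \<in> free_product_words I G"
  by (auto simp: free_product_words_def)

lemma free_product_words_Nil: "[] \<in> free_product_words I G"
  by (simp add: free_product_words_def)

lemma free_product_words_Cons:
  "(i, x) # w \<in> free_product_words I G \<longleftrightarrow>
    i \<in> I \<and> x \<in> carrier (G i) \<and> w \<in> free_product_words I G"
  by (auto simp: free_product_words_def)

lemmas free_product_words_simps =
  free_product_words_append free_product_words_Nil free_product_words_Cons

lemma free_product_rel_words:
  "(u, v) \<in> free_product_rel I G \<Longrightarrow> u \<in> free_product_words I G \<and> v \<in> free_product_words I G"
proof (induction rule: free_product_rel.induct)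
  case (unit u v i)
  then show ?case
    using grp[of i] by (simp add: free_product_words_simps group.is_monoid monoid.one_closed)
next
  case (mult u v i x y)
  then show ?case
    using grp[of i] by (simp add: free_product_words_simps group.is_monoid monoid.m_closed)
qed auto

lemma equiv_free_product_rel: "equiv (free_product_words I G) (free_product_rel I G)"
proof (rule equivI)
  show "R \<subseteq> W \<times> W" using free_product_rel_words by auto
  show "refl_on W R" by (rule refl_onI) (rule free_product_rel.refl)
  show "Relation.sym R" by (rule symI) (rule free_product_rel.sym)
  show "Relation.trans R" by (rule transI) (rule free_product_rel.trans)
qed

lemma free_product_rel_context:
  assumes "(u, v) \<in> R" "a \<in> W" "b \<in> W"
  shows "(a @ u @ b, a @ v @ b) \<in> R"
  using assms
proof (induction rule: free_product_rel.induct)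
  case (refl w)
  then show ?case by (simp add: free_product_rel.refl free_product_words_simps)
next
  case (sym v w)
  then show ?case by (simp add: free_product_rel.sym)
next
  case (trans u v w)
  then show ?case using free_product_rel.trans by metis
next
  case (unit u v i)
  then show ?case
    using free_product_rel.unit[of "a @ u" I G "v @ b" i] by (simp add: free_product_words_simps)
next
  case (mult u v i x y)
  then show ?case
    using free_product_rel.mult[of "a @ u" I G "v @ b" i x y]
    by (simp add: free_product_words_simps)
qed

lemma free_product_rel_append:
  assumes "(u, u') \<in> R" "(v, v') \<in> R"
  shows "(u @ v, u' @ v') \<in> R"
proof (rule free_product_rel.trans)
  show "(u @ v, u' @ v) \<in> R"
    using free_product_rel_context[of u u' "[]" v] assms free_product_rel_words
    by (auto simp: free_product_words_simps)
  show "(u' @ v, u' @ v') \<in> R"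
    using free_product_rel_context[of v v' u' "[]"] assms free_product_rel_words
    by (auto simp: free_product_words_simps)
qed

lemma free_product_mult:
  assumes "u \<in> free_product_words I G" "v \<in> free_product_words I G"
  shows "free_product_rel I G `` {u} \<otimes>\<^bsub>free_product I G\<^esub> free_product_rel I G `` {v}
    = free_product_rel I G `` {u @ v}"
proof -
  have eq: "R `` {u' @ v'} = R `` {u @ v}" if "u' \<in> R `` {u}" "v' \<in> R `` {v}" for u' v'
  proof (rule equiv_class_eq[OF equiv_free_product_rel, symmetric])
    show "(u @ v, u' @ v') \<in> R"
      using that by (intro free_product_rel_append) simp_all
  qed
  have ne: "u \<in> R `` {u}" "v \<in> R `` {v}"
    using free_product_rel.refl assms by simp_all
  have "(\<Union>u'\<in>R `` {u}. \<Union>v'\<in>R `` {v}. R `` {u' @ v'})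
      = (\<Union>u'\<in>R `` {u}. \<Union>v'\<in>R `` {v}. R `` {u @ v})"
    using eq by (intro SUP_cong) simp_all
  also have "\<dots> = R `` {u @ v}"
    using ne by blast
  finally show ?thesis
    by (simp only: free_product_def monoid.simps)
qed

lemma free_product_carrierE:
  assumes "A \<in> carrier (free_product I G)"
  obtains w where "w \<in> free_product_words I G" "A = free_product_rel I G `` {w}"
  using assms unfolding free_product_def partial_object.simps by (blast elim: quotientE)

lemma free_product_carrierI:
  "w \<in> free_product_words I G \<Longrightarrow> free_product_rel I G `` {w} \<in> carrier (free_product I G)"
  by (simp add: free_product_def quotientI)

lemma free_product_one: "\<one>\<^bsub>free_product I G\<^esub> = free_product_rel I G `` {[]}"
  by (simp add: free_product_def)

lemma free_product_left_inverse:
  assumes "w \<in> W"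
  shows "\<exists>v\<in>W. (v @ w, []) \<in> R"
  using assms
proof (induction w)
  case Nil
  show ?case by (rule bexI[of _ "[]"]) (auto simp: free_product_words_Nil intro: free_product_rel.refl)
next
  case (Cons a w)
  obtain i x where a: "a = (i, x)" by (cases a)
  from Cons a have i: "i \<in> I" "x \<in> carrier (G i)" "w \<in> W"
    by (auto simp: free_product_words_simps)
  then obtain v where v: "v \<in> W" "(v @ w, []) \<in> R" using Cons.IH by blast
  interpret Gi: group "G i" using grp i by blast
  let ?v = "v @ [(i, inv\<^bsub>G i\<^esub> x)]"
  have "(?v @ a # w, v @ [(i, \<one>\<^bsub>G i\<^esub>)] @ w) \<in> R"
    using free_product_rel.mult[of v I G w i "inv\<^bsub>G i\<^esub> x" x] v i a by simp
  then have "(?v @ a # w, v @ w) \<in> R"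
    using free_product_rel.trans free_product_rel.unit[of v I G w i] v(1) i by fastforce
  then have "(?v @ a # w, []) \<in> R"
    using v(2) by (rule free_product_rel.trans)
  moreover have "?v \<in> W" using v i by (simp add: free_product_words_simps)
  ultimately show ?case by blast
qed

lemma group_free_product: "group (free_product I G)"
proof (rule groupI)
  let ?F = "free_product I G"
  show "\<one>\<^bsub>?F\<^esub> \<in> carrier ?F"
    by (simp add: free_product_one free_product_carrierI free_product_words_Nil)
next
  let ?F = "free_product I G"
  fix A B C assume A: "A \<in> carrier ?F" and B: "B \<in> carrier ?F"
  then obtain u v where u: "u \<in> W" "A = R `` {u}" and v: "v \<in> W" "B = R `` {v}"
    by (metis free_product_carrierE)
  then show "A \<otimes>\<^bsub>?F\<^esub> B \<in> carrier ?F"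
    by (simp add: free_product_mult free_product_carrierI free_product_words_simps)
  assume C: "C \<in> carrier ?F"
  then obtain w where w: "w \<in> W" "C = R `` {w}"
    by (metis free_product_carrierE)
  show "A \<otimes>\<^bsub>?F\<^esub> B \<otimes>\<^bsub>?F\<^esub> C = A \<otimes>\<^bsub>?F\<^esub> (B \<otimes>\<^bsub>?F\<^esub> C)"
    using u v w by (simp add: free_product_mult free_product_words_simps)
next
  let ?F = "free_product I G"
  fix A assume "A \<in> carrier ?F"
  then obtain u where u: "u \<in> W" "A = R `` {u}" by (metis free_product_carrierE)
  show "\<one>\<^bsub>?F\<^esub> \<otimes>\<^bsub>?F\<^esub> A = A"
    using u by (simp add: free_product_one free_product_mult free_product_words_simps)
  obtain v where v: "v \<in> W" "(v @ u, []) \<in> R"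
    using free_product_left_inverse u by blast
  then have "R `` {v} \<otimes>\<^bsub>?F\<^esub> A = \<one>\<^bsub>?F\<^esub>"
    using u equiv_class_eq[OF equiv_free_product_rel v(2)]
    by (simp add: free_product_one free_product_mult)
  then show "\<exists>B\<in>carrier ?F. B \<otimes>\<^bsub>?F\<^esub> A = \<one>\<^bsub>?F\<^esub>"
    using v free_product_carrierI by blast
qed

lemma free_product_inj_hom:
  assumes "i \<in> I"
  shows "free_product_inj I G i \<in> hom (G i) (free_product I G)"
proof (rule homI)
  interpret Gi: group "G i" using grp assms by blast
  fix x y assume x: "x \<in> carrier (G i)" and y: "y \<in> carrier (G i)"
  show "free_product_inj I G i x \<in> carrier (free_product I G)"
    using assms x by (simp add: free_product_inj_def free_product_carrierI free_product_words_simps)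
  have "([(i, x), (i, y)], [(i, x \<otimes>\<^bsub>G i\<^esub> y)]) \<in> R"
    using free_product_rel.mult[of "[]" I G "[]" i x y] assms x y
    by (simp add: free_product_words_simps)
  then show "free_product_inj I G i (x \<otimes>\<^bsub>G i\<^esub> y)
      = free_product_inj I G i x \<otimes>\<^bsub>free_product I G\<^esub> free_product_inj I G i y"
    using assms x y equiv_class_eq[OF equiv_free_product_rel]
    by (simp add: free_product_inj_def free_product_mult free_product_words_simps)
qed

text \<open>The existence part of the universal property.\<close>

lemma free_product_universal:
  fixes H :: "('c, 'd) monoid_scheme"
  assumes "group H" and h: "\<And>i. i \<in> I \<Longrightarrow> h i \<in> hom (G i) H"
  shows "\<exists>\<phi>\<in>hom (free_product I G) H.
    (\<forall>i\<in>I. \<forall>x\<in>carrier (G i). \<phi> (free_product_inj I G i x) = h i x)"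
proof -
  interpret H: group H by fact
  define ev where "ev = (\<lambda>w. foldr (\<lambda>(i, x) z. h i x \<otimes>\<^bsub>H\<^esub> z) w \<one>\<^bsub>H\<^esub>)"
  have ev_Nil: "ev [] = \<one>\<^bsub>H\<^esub>" by (simp add: ev_def)
  have ev_Cons: "ev ((i, x) # w) = h i x \<otimes>\<^bsub>H\<^esub> ev w" for i x w by (simp add: ev_def)
  have hc: "h i x \<in> carrier H" if "i \<in> I" "x \<in> carrier (G i)" for i x
    using h[OF that(1)] that(2) by (auto simp: hom_def)
  have hm: "h i (x \<otimes>\<^bsub>G i\<^esub> y) = h i x \<otimes>\<^bsub>H\<^esub> h i y"
    if "i \<in> I" "x \<in> carrier (G i)" "y \<in> carrier (G i)" for i x y
    using h[OF that(1)] that(2,3) by (auto simp: hom_def)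
  have h1: "h i \<one>\<^bsub>G i\<^esub> = \<one>\<^bsub>H\<^esub>" if "i \<in> I" for i
    using hom_one[OF h[OF that] grp[OF that] \<open>group H\<close>] .
  have evc: "ev w \<in> carrier H" if "w \<in> W" for w
    using that by (induction w) (auto simp: ev_Nil ev_Cons free_product_words_simps hc)
  have ev_app: "ev (u @ v) = ev u \<otimes>\<^bsub>H\<^esub> ev v" if "u \<in> W" "v \<in> W" for u v
    using that
    by (induction u) (auto simp: ev_Nil ev_Cons free_product_words_simps hc evc H.m_assoc)
  have ev_rel: "ev u = ev v" if "(u, v) \<in> R" for u v
    using that
  proof (induction rule: free_product_rel.induct)
    case (unit u v i)
    interpret Gi: group "G i" using grp unit by blast
    from unit show ?case
      by (simp add: ev_app ev_Cons free_product_words_simps h1 evc)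
  next
    case (mult u v i x y)
    interpret Gi: group "G i" using grp mult by blast
    from mult show ?case
      by (simp add: ev_app ev_Cons free_product_words_simps hm hc evc H.m_assoc)
  qed auto
  define \<phi> where "\<phi> = (\<lambda>A. ev (SOME w. w \<in> A))"
  have \<phi>: "\<phi> (R `` {w}) = ev w" if "w \<in> W" for w
  proof -
    have "(w, SOME v. v \<in> R `` {w}) \<in> R"
      using someI_ex[of "\<lambda>v. v \<in> R `` {w}"] free_product_rel.refl[OF that] by blast
    then show ?thesis using ev_rel by (simp add: \<phi>_def)
  qed
  have "\<phi> \<in> hom (free_product I G) H"
    by (rule homI; elim free_product_carrierE)
       (auto simp: free_product_mult \<phi> ev_app evc free_product_words_simps)
  moreover have "\<phi> (free_product_inj I G i x) = h i x" if "i \<in> I" "x \<in> carrier (G i)" for i x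
    using that by (simp add: free_product_inj_def \<phi> ev_Cons ev_Nil free_product_words_simps hc)
  ultimately show ?thesis by blast
qed

end


section \<open>Completions\<close>

text \<open>
  Let \<open>\<N>\<close> be a set of normal subgroups of \<open>\<Gamma>\<close>. An element of the inverse limit of the
  quotients \<open>\<Gamma> Mod N\<close> is a family \<open>f\<close> of cosets, \<open>f N\<close> being a coset of \<open>N\<close>. For \<open>M \<subseteq> N\<close>
  the canonical projection from \<open>\<Gamma> Mod M\<close> to \<open>\<Gamma> Mod N\<close> sends the coset \<open>M #> g\<close> to
  \<open>N #> g\<close>, which is \<open>N <#> (M #> g)\<close>.
\<close>

definition quotient_limit :: "('a, 'b) monoid_scheme \<Rightarrow> 'a set set \<Rightarrow> ('a set \<Rightarrow> 'a set) monoid"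
  where "quotient_limit \<Gamma> \<N> = (product_group \<N> (\<lambda>N. \<Gamma> Mod N))
    \<lparr> carrier := {f \<in> \<Pi>\<^sub>E N\<in>\<N>. carrier (\<Gamma> Mod N).
        \<forall>M\<in>\<N>. \<forall>N\<in>\<N>. M \<subseteq> N \<longrightarrow> N <#>\<^bsub>\<Gamma>\<^esub> f M = f N} \<rparr>"

definition quotient_limit_topology ::
  "('a, 'b) monoid_scheme \<Rightarrow> 'a set set \<Rightarrow> ('a set \<Rightarrow> 'a set) topology"
  where "quotient_limit_topology \<Gamma> \<N> =
    subtopology (product_topology (\<lambda>N. discrete_topology (carrier (\<Gamma> Mod N))) \<N>)
      (carrier (quotient_limit \<Gamma> \<N>))"

lemma topspace_quotient_limit_topology:
  "topspace (quotient_limit_topology \<Gamma> \<N>) = carrier (quotient_limit \<Gamma> \<N>)"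
  by (auto simp: quotient_limit_topology_def quotient_limit_def)

lemma group_quotient_limit:
  assumes "group \<Gamma>" and nrm: "\<And>N. N \<in> \<N> \<Longrightarrow> N \<lhd> \<Gamma>"
  shows "group (quotient_limit \<Gamma> \<N>)"
proof -
  interpret group \<Gamma> by fact
  let ?P = "product_group \<N> (\<lambda>N. \<Gamma> Mod N)"
  let ?L = "{f \<in> \<Pi>\<^sub>E N\<in>\<N>. carrier (\<Gamma> Mod N). \<forall>M\<in>\<N>. \<forall>N\<in>\<N>. M \<subseteq> N \<longrightarrow> N <#>\<^bsub>\<Gamma>\<^esub> f M = f N}"
  have grp: "group (\<Gamma> Mod N)" if "N \<in> \<N>" for N
    using nrm[OF that] by (rule normal.factorgroup_is_group)
  interpret P: group ?P using grp by simp
  have proj: "(\<lambda>A. N <#>\<^bsub>\<Gamma>\<^esub> A) \<in> hom (\<Gamma> Mod M) (\<Gamma> Mod N)"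
    if "M \<in> \<N>" "N \<in> \<N>" "M \<subseteq> N" for M N
  proof -
    interpret M: normal M \<Gamma> using nrm that by blast
    interpret N: normal N \<Gamma> using nrm that by blast
    have NM: "N <#>\<^bsub>\<Gamma>\<^esub> (M #>\<^bsub>\<Gamma>\<^esub> g) = N #>\<^bsub>\<Gamma>\<^esub> g" if "g \<in> carrier \<Gamma>" for g
    proof -
      have "N <#>\<^bsub>\<Gamma>\<^esub> M = N"
      proof
        show "N <#>\<^bsub>\<Gamma>\<^esub> M \<subseteq> N"
          using \<open>M \<subseteq> N\<close> by (auto simp: set_mult_def)
        show "N \<subseteq> N <#>\<^bsub>\<Gamma>\<^esub> M"
        proof
          fix x assume x: "x \<in> N"
          then have "x = x \<otimes>\<^bsub>\<Gamma>\<^esub> \<one>\<^bsub>\<Gamma>\<^esub>" using N.subset by auto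
          then show "x \<in> N <#>\<^bsub>\<Gamma>\<^esub> M" using x M.one_closed unfolding set_mult_def by blast
        qed
      qed
      then show ?thesis
        using setmult_rcos_assoc[OF N.subset M.subset that] by simp
    qed
    show ?thesis
    proof (rule homI)
      fix A B assume "A \<in> carrier (\<Gamma> Mod M)" "B \<in> carrier (\<Gamma> Mod M)"
      then obtain a b where ab: "a \<in> carrier \<Gamma>" "b \<in> carrier \<Gamma>"
          "A = M #>\<^bsub>\<Gamma>\<^esub> a" "B = M #>\<^bsub>\<Gamma>\<^esub> b"
        unfolding FactGroup_def RCOSETS_def by auto
      then show "N <#>\<^bsub>\<Gamma>\<^esub> A \<in> carrier (\<Gamma> Mod N)"
        unfolding FactGroup_def RCOSETS_def by (auto simp: NM)
      show "N <#>\<^bsub>\<Gamma>\<^esub> (A \<otimes>\<^bsub>\<Gamma> Mod M\<^esub> B)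
          = (N <#>\<^bsub>\<Gamma>\<^esub> A) \<otimes>\<^bsub>\<Gamma> Mod N\<^esub> (N <#>\<^bsub>\<Gamma>\<^esub> B)"
        using ab by (simp add: NM M.rcos_sum N.rcos_sum)
    qed
  qed
  have cP: "f N \<in> carrier (\<Gamma> Mod N)" if "f \<in> carrier ?P" "N \<in> \<N>" for f N
    using that by (simp add: PiE_iff)
  have LI: "f \<in> ?L" if "f \<in> carrier ?P"
    and "\<And>M N. M \<in> \<N> \<Longrightarrow> N \<in> \<N> \<Longrightarrow> M \<subseteq> N \<Longrightarrow> N <#>\<^bsub>\<Gamma>\<^esub> f M = f N" for f
    using that by simp
  have LD1: "f \<in> carrier ?P" if "f \<in> ?L" for f
    using that by simp
  have LD2: "N <#>\<^bsub>\<Gamma>\<^esub> f M = f N" if "f \<in> ?L" "M \<in> \<N>" "N \<in> \<N>" "M \<subseteq> N" for f M N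
    using that by simp
  have "subgroup ?L ?P"
  proof (rule P.subgroupI)
    show "?L \<subseteq> carrier ?P" using LD1 by (rule subsetI)
    have "\<one>\<^bsub>?P\<^esub> \<in> ?L"
    proof (rule LI[OF P.one_closed])
      fix M N assume MN: "M \<in> \<N>" "N \<in> \<N>" "M \<subseteq> N"
      then show "N <#>\<^bsub>\<Gamma>\<^esub> \<one>\<^bsub>?P\<^esub> M = \<one>\<^bsub>?P\<^esub> N"
        using hom_one[OF proj[OF MN] grp[OF MN(1)] grp[OF MN(2)]] by simp
    qed
    then show "?L \<noteq> {}" by (rule ex_in_conv[THEN iffD1, OF exI])
  next
    fix f assume f: "f \<in> ?L"
    note fc = LD1[OF f]
    have inv_f: "inv\<^bsub>?P\<^esub> f = (\<lambda>N\<in>\<N>. inv\<^bsub>\<Gamma> Mod N\<^esub> f N)"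
      using fc grp by (intro inv_product_group) simp_all
    show "inv\<^bsub>?P\<^esub> f \<in> ?L"
    proof (rule LI[OF P.inv_closed[OF fc]])
      fix M N assume MN: "M \<in> \<N>" "N \<in> \<N>" "M \<subseteq> N"
      have "group_hom (\<Gamma> Mod M) (\<Gamma> Mod N) (\<lambda>A. N <#>\<^bsub>\<Gamma>\<^esub> A)"
        using proj[OF MN] grp[OF MN(1)] grp[OF MN(2)]
        by (simp add: group_hom_def group_hom_axioms_def)
      then show "N <#>\<^bsub>\<Gamma>\<^esub> (inv\<^bsub>?P\<^esub> f) M = (inv\<^bsub>?P\<^esub> f) N"
        unfolding inv_f using group_hom.hom_inv cP[OF fc MN(1)] LD2[OF f MN] MN by fastforce
    qed
  next
    fix f g assume f: "f \<in> ?L" and g: "g \<in> ?L"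
    note fc = LD1[OF f] and gc = LD1[OF g]
    show "f \<otimes>\<^bsub>?P\<^esub> g \<in> ?L"
    proof (rule LI[OF P.m_closed[OF fc gc]])
      fix M N assume MN: "M \<in> \<N>" "N \<in> \<N>" "M \<subseteq> N"
      then show "N <#>\<^bsub>\<Gamma>\<^esub> (f \<otimes>\<^bsub>?P\<^esub> g) M = (f \<otimes>\<^bsub>?P\<^esub> g) N"
        using hom_mult[OF proj[OF MN] cP[OF fc MN(1)] cP[OF gc MN(1)]] LD2[OF f MN] LD2[OF g MN]
        by simp
    qed
  qed
  then show ?thesis
    unfolding quotient_limit_def by (rule P.subgroup_imp_group)
qed

definition finite_quotient_kernels :: "('a, 'b) monoid_scheme \<Rightarrow> 'a set set"
  where "finite_quotient_kernels \<Gamma> = {N. N \<lhd> \<Gamma> \<and> finite (carrier (\<Gamma> Mod N))}"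

definition finite_solvable_quotient_kernels :: "('a, 'b) monoid_scheme \<Rightarrow> 'a set set"
  where "finite_solvable_quotient_kernels \<Gamma> =
    {N. N \<lhd> \<Gamma> \<and> finite (carrier (\<Gamma> Mod N)) \<and> solvable (\<Gamma> Mod N)}"

definition profinite_completion :: "('a, 'b) monoid_scheme \<Rightarrow> ('a set \<Rightarrow> 'a set) monoid"
  where "profinite_completion \<Gamma> = quotient_limit \<Gamma> (finite_quotient_kernels \<Gamma>)"

definition profinite_topology :: "('a, 'b) monoid_scheme \<Rightarrow> ('a set \<Rightarrow> 'a set) topology"
  where "profinite_topology \<Gamma> = quotient_limit_topology \<Gamma> (finite_quotient_kernels \<Gamma>)"

definition prosolvable_completion :: "('a, 'b) monoid_scheme \<Rightarrow> ('a set \<Rightarrow> 'a set) monoid"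
  where "prosolvable_completion \<Gamma> = quotient_limit \<Gamma> (finite_solvable_quotient_kernels \<Gamma>)"

definition prosolvable_topology :: "('a, 'b) monoid_scheme \<Rightarrow> ('a set \<Rightarrow> 'a set) topology"
  where "prosolvable_topology \<Gamma> = quotient_limit_topology \<Gamma> (finite_solvable_quotient_kernels \<Gamma>)"


section \<open>Topological generation\<close>

text \<open>
  The minimal number of topological generators of a group \<open>P\<close> with topology \<open>T\<close> on its carrier.
  It is \<open>\<infinity>\<close> if no finite set generates a dense subgroup (\<open>Inf {} = \<infinity>\<close> in \<open>enat\<close>).
\<close>

definition topologically_generates ::
  "('a, 'b) monoid_scheme \<Rightarrow> 'a topology \<Rightarrow> 'a set \<Rightarrow> bool"
  where "topologically_generates P T S \<longleftrightarrow>
    S \<subseteq> carrier P \<and> Abstract_Topology.closure_of T (generate P S) = carrier P"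

definition min_top_generators :: "('a, 'b) monoid_scheme \<Rightarrow> 'a topology \<Rightarrow> enat"
  where "min_top_generators P T =
    Inf {enat (card S) | S. finite S \<and> topologically_generates P T S}"

end

theory Submission
  imports
    Defs
    "HOL-Algebra.Algebraic_Closure_Type"
    "HOL-Library.Function_Algebras"
    "HOL-Library.Z2"
begin

text \<open>
  For each \<open>i\<close> let \<open>m\<^sub>i \<ge> 2\<close> be the order of \<open>G\<^sub>i\<close> and \<open>\<zeta>\<^sub>i\<close> a root of \<open>1 + X + \<dots> + X\<^bsup>m\<^sub>i - 1\<^esup>\<close> in the
  algebraic closure \<open>K\<close> of the field with two elements. Every affine map \<open>w \<mapsto> v + \<zeta>\<^sub>i w\<close> then has
  order dividing \<open>m\<^sub>i\<close>, whatever the vector \<open>v\<close>. Hence \<open>\<Gamma>\<close> acts on \<open>K\<^sup>n\<close> by letting the generator of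
  \<open>G\<^sub>i\<close> act as \<open>w \<mapsto> e\<^sub>i + \<zeta>\<^sub>i w\<close>, and the image lies in a finite metabelian group. The translation
  parts of a subgroup generated by \<open>d\<close> affine maps with scalar linear parts lie in a subspace of
  dimension at most \<open>d\<close>. The image of \<open>\<Gamma>\<close> has all \<open>e\<^sub>i\<close> among its translation parts, so it needs
  \<open>n\<close> generators, and the completions need at least as many as this finite solvable quotient.
\<close>

section \<open>Finite solvable quotients\<close>

lemma comm_group_imp_solvable:
  assumes "comm_group G"
  shows "solvable G"
proof -
  interpret comm_group G by fact
  have "(derived G ^^ 1) (carrier G) = {\<one>\<^bsub>G\<^esub>}"
    using derived_eq_singleton by simp
  then show ?thesis
    unfolding solvable_iff_trivial_derived_seq by blast
qed

text \<open>The projection \<open>snd\<close> makes the product an extension of \<open>H\<close> by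
  a copy of \<open>G\<close>, and an extension of solvable groups is solvable.\<close>

lemma solvable_DirProd:
  assumes "group G" "group H" "solvable G" "solvable H"
  shows "solvable (G \<times>\<times> H)"
proof (rule solvable_condition)
  interpret G: group G by fact
  interpret H: group H by fact
  have GH: "group (G \<times>\<times> H)" by (rule DirProd_group) fact+
  show "group_hom G (G \<times>\<times> H) (\<lambda>x. (x, \<one>\<^bsub>H\<^esub>))"
    using GH assms by (auto simp: group_hom_def group_hom_axioms_def hom_def)
  show "group_hom (G \<times>\<times> H) H snd"
    using GH assms by (auto simp: group_hom_def group_hom_axioms_def hom_def)
  show "snd ` carrier (G \<times>\<times> H) = carrier H"
    using G.one_closed by (force simp: image_iff)
  show "kernel (G \<times>\<times> H) H snd \<subseteq> (\<lambda>x. (x, \<one>\<^bsub>H\<^esub>)) ` carrier G"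
    by (auto simp: kernel_def)
qed fact+

text \<open>A homomorphism is constant on the cosets of its kernel, so \<open>the_elem\<close> reads
  off the common value. The resulting injection into \<open>H\<close> carries finiteness and
  solvability of \<open>H\<close> over to the quotient by the kernel.\<close>

lemma (in group_hom) FactGroup_kernel_the_elem_group_hom:
  "group_hom (G Mod kernel G H h) H (\<lambda>C. the_elem (h ` C))"
  using FactGroup_hom normal.factorgroup_is_group[OF normal_kernel]
  by (simp add: group_hom_def group_hom_axioms_def)

lemma (in group_hom) finite_FactGroup_kernel:
  assumes "finite (carrier H)"
  shows "finite (carrier (G Mod kernel G H h))"
  by (rule inj_on_finite[OF FactGroup_inj_on _ assms]) (auto simp: FactGroup_the_elem_mem)

lemma (in group_hom) solvable_FactGroup_kernel:
  assumes "solvable H"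
  shows "solvable (G Mod kernel G H h)"
  using group_hom.inj_hom_imp_solvable[OF FactGroup_kernel_the_elem_group_hom FactGroup_inj_on assms] .

lemma (in group_hom) kernel_in_finite_quotient_kernels:
  assumes "finite (carrier H)"
  shows "kernel G H h \<in> finite_quotient_kernels G"
  using assms by (simp add: finite_quotient_kernels_def normal_kernel finite_FactGroup_kernel)

lemma (in group_hom) kernel_in_finite_solvable_quotient_kernels:
  assumes "finite (carrier H)" "solvable H"
  shows "kernel G H h \<in> finite_solvable_quotient_kernels G"
  using assms
  by (simp add: finite_solvable_quotient_kernels_def normal_kernel finite_FactGroup_kernel
      solvable_FactGroup_kernel)

text \<open>Writing \<open>M \<inter> N\<close> as a kernel embeds the quotient by it into the
  product of the quotients by \<open>M\<close> and \<open>N\<close>. Hence both families of kernels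
  are closed under intersection, on which the density argument for inverse limits rests.\<close>

lemma (in group) coset_pair_group_hom:
  assumes "M \<lhd> G" "N \<lhd> G"
  shows "group_hom G ((G Mod M) \<times>\<times> (G Mod N)) (\<lambda>g. (M #> g, N #> g))"
    and "kernel G ((G Mod M) \<times>\<times> (G Mod N)) (\<lambda>g. (M #> g, N #> g)) = M \<inter> N"
proof -
  interpret M: normal M G by fact
  interpret N: normal N G by fact
  have "group ((G Mod M) \<times>\<times> (G Mod N))"
    by (intro DirProd_group M.factorgroup_is_group N.factorgroup_is_group)
  moreover have "(\<lambda>g. (M #> g, N #> g)) \<in> hom G ((G Mod M) \<times>\<times> (G Mod N))"
    by (rule hom_paired[THEN iffD2]) (simp add: M.r_coset_hom_Mod N.r_coset_hom_Mod)
  ultimately show "group_hom G ((G Mod M) \<times>\<times> (G Mod N)) (\<lambda>g. (M #> g, N #> g))"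
    by (simp add: group_hom_def group_hom_axioms_def is_group)
  have mem: "M #> g = M \<longleftrightarrow> g \<in> M" "N #> g = N \<longleftrightarrow> g \<in> N" if "g \<in> carrier G" for g
    using that M.rcos_const[OF is_group] coset_join1[OF _ that] M.subgroup_axioms M.subset
      N.rcos_const[OF is_group] N.subgroup_axioms N.subset by blast+
  have "kernel G ((G Mod M) \<times>\<times> (G Mod N)) (\<lambda>g. (M #> g, N #> g))
      = {g \<in> carrier G. M #> g = M \<and> N #> g = N}"
    by (simp add: kernel_def)
  also have "\<dots> = {g \<in> carrier G. g \<in> M \<and> g \<in> N}"
    using mem by blast
  finally show "kernel G ((G Mod M) \<times>\<times> (G Mod N)) (\<lambda>g. (M #> g, N #> g)) = M \<inter> N"
    using M.subset by blast
qed

lemma (in group) finite_quotient_kernels_Int: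
  assumes "M \<in> finite_quotient_kernels G" "N \<in> finite_quotient_kernels G"
  shows "M \<inter> N \<in> finite_quotient_kernels G"
proof -
  have M: "M \<lhd> G" "finite (carrier (G Mod M))" and N: "N \<lhd> G" "finite (carrier (G Mod N))"
    using assms by (auto simp: finite_quotient_kernels_def)
  show ?thesis
    using group_hom.kernel_in_finite_quotient_kernels[OF coset_pair_group_hom(1)[OF M(1) N(1)]] M N
    by (simp add: coset_pair_group_hom(2))
qed

lemma (in group) finite_solvable_quotient_kernels_Int:
  assumes "M \<in> finite_solvable_quotient_kernels G" "N \<in> finite_solvable_quotient_kernels G"
  shows "M \<inter> N \<in> finite_solvable_quotient_kernels G"
proof -
  have M: "M \<lhd> G" "finite (carrier (G Mod M))" "solvable (G Mod M)"
    and N: "N \<lhd> G" "finite (carrier (G Mod N))" "solvable (G Mod N)"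
    using assms by (auto simp: finite_solvable_quotient_kernels_def)
  have "solvable ((G Mod M) \<times>\<times> (G Mod N))"
    using M N by (intro solvable_DirProd normal.factorgroup_is_group)
  then show ?thesis
    using group_hom.kernel_in_finite_solvable_quotient_kernels[OF coset_pair_group_hom(1)[OF M(1) N(1)]] M N
    by (simp add: coset_pair_group_hom(2))
qed

section \<open>Generators of inverse limits\<close>

lemma quotient_limit_eval_group_hom:
  assumes "group \<Gamma>" "\<And>N. N \<in> \<N> \<Longrightarrow> N \<lhd> \<Gamma>" "K \<in> \<N>"
  shows "group_hom (quotient_limit \<Gamma> \<N>) (\<Gamma> Mod K) (\<lambda>f. f K)"
  using group_quotient_limit[OF assms(1,2)] normal.factorgroup_is_group[OF assms(2)[OF assms(3)]] assms(3)
  by (auto simp: group_hom_def group_hom_axioms_def hom_def quotient_limit_def PiE_iff)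

text \<open>The canonical map from \<open>\<Gamma>\<close> to the inverse limit. It is restricted to
  \<open>\<N>\<close> because elements of the limit are extensional functions.\<close>

definition coset_family :: "('a, 'b) monoid_scheme \<Rightarrow> 'a set set \<Rightarrow> 'a \<Rightarrow> 'a set \<Rightarrow> 'a set"
  where "coset_family \<Gamma> \<N> g = (\<lambda>N\<in>\<N>. N #>\<^bsub>\<Gamma>\<^esub> g)"

text \<open>\<open>M\<close> contains the identity and lies in \<open>N\<close>, so
  \<open>N <#> M = N\<close>. This is the compatibility condition that places coset families in the
  inverse limit.\<close>

lemma (in group) subset_set_mult_rcoset:
  assumes "M \<lhd> G" "N \<lhd> G" "M \<subseteq> N" "g \<in> carrier G"
  shows "N <#> (M #> g) = N #> g"
proof -
  interpret M: normal M G by fact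
  interpret N: normal N G by fact
  have "N <#> M = N"
  proof
    show "N <#> M \<subseteq> N"
      using \<open>M \<subseteq> N\<close> by (auto simp: set_mult_def)
    have "x \<in> N <#> M" if "x \<in> N" for x
      unfolding set_mult_def using that M.one_closed r_one[OF subsetD[OF N.subset that]] by blast
    then show "N \<subseteq> N <#> M" ..
  qed
  then show ?thesis
    using setmult_rcos_assoc[OF N.subset M.subset assms(4)] by simp
qed

lemma coset_family_group_hom:
  assumes "group \<Gamma>" "\<And>N. N \<in> \<N> \<Longrightarrow> N \<lhd> \<Gamma>"
  shows "group_hom \<Gamma> (quotient_limit \<Gamma> \<N>) (coset_family \<Gamma> \<N>)"
proof -
  interpret group \<Gamma> by fact
  have c: "coset_family \<Gamma> \<N> g \<in> carrier (quotient_limit \<Gamma> \<N>)" if "g \<in> carrier \<Gamma>" for g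
    using that subset_set_mult_rcoset[OF assms(2) assms(2)]
    by (auto simp: quotient_limit_def coset_family_def FactGroup_def RCOSETS_def)
  have m: "coset_family \<Gamma> \<N> (g \<otimes>\<^bsub>\<Gamma>\<^esub> h)
      = coset_family \<Gamma> \<N> g \<otimes>\<^bsub>quotient_limit \<Gamma> \<N>\<^esub> coset_family \<Gamma> \<N> h"
    if "g \<in> carrier \<Gamma>" "h \<in> carrier \<Gamma>" for g h
    using that normal.rcos_sum[OF assms(2)]
    by (auto simp: quotient_limit_def coset_family_def fun_eq_iff)
  show ?thesis
    using c m group_quotient_limit[OF assms] assms(1)
    by (auto simp: group_hom_def group_hom_axioms_def hom_def)
qed

text \<open>Evaluation at \<open>K\<close> is continuous into a discrete space, so every condition
  on this single coordinate is open.\<close>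

lemma openin_quotient_limit_topology_eval:
  assumes "K \<in> \<N>" "C \<subseteq> carrier (\<Gamma> Mod K)"
  shows "openin (quotient_limit_topology \<Gamma> \<N>) {f \<in> carrier (quotient_limit \<Gamma> \<N>). f K \<in> C}"
proof -
  let ?T = "\<lambda>N. discrete_topology (carrier (\<Gamma> Mod N))"
  have "openin (product_topology ?T \<N>) {f \<in> topspace (product_topology ?T \<N>). f K \<in> C}"
    by (rule openin_continuous_map_preimage[OF continuous_map_product_projection[OF assms(1)]])
      (simp add: assms(2))
  moreover have "{f \<in> carrier (quotient_limit \<Gamma> \<N>). f K \<in> C}
      = {f \<in> topspace (product_topology ?T \<N>). f K \<in> C} \<inter> carrier (quotient_limit \<Gamma> \<N>)"
    by (auto simp: quotient_limit_def)
  ultimately show ?thesis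
    unfolding quotient_limit_topology_def openin_subtopology by blast
qed

text \<open>Source of the lower bound: a dense subgroup of the limit reaches every coset of the
  kernel, so the images in \<open>H\<close> of topological generators generate at least the image of
  \<open>\<phi>\<close>.\<close>

lemma topologically_generates_quotient_image:
  assumes "group \<Gamma>" "\<And>N. N \<in> \<N> \<Longrightarrow> N \<lhd> \<Gamma>" "group_hom \<Gamma> H \<phi>" "kernel \<Gamma> H \<phi> \<in> \<N>"
    and gen: "topologically_generates (quotient_limit \<Gamma> \<N>) (quotient_limit_topology \<Gamma> \<N>) S"
  obtains \<psi> where "\<psi> ` S \<subseteq> carrier H" "\<phi> ` carrier \<Gamma> \<subseteq> generate H (\<psi> ` S)"
proof -
  let ?L = "quotient_limit \<Gamma> \<N>" and ?K = "kernel \<Gamma> H \<phi>"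
  interpret \<phi>: group_hom \<Gamma> H \<phi> by fact
  \<comment> \<open>Evaluation at the kernel, followed by the embedding of the quotient into
    \<open>H\<close>. It sends the coset family of \<open>g\<close> to
    \<open>\<phi> g\<close>.\<close>
  define \<psi> where "\<psi> = (\<lambda>C. the_elem (\<phi> ` C)) \<circ> (\<lambda>f. f ?K)"
  interpret ev: group_hom ?L "\<Gamma> Mod ?K" "\<lambda>f. f ?K"
    by (rule quotient_limit_eval_group_hom) (fact assms)+
  have "\<psi> \<in> hom ?L H"
    unfolding \<psi>_def using ev.homh \<phi>.FactGroup_hom by (rule hom_compose)
  then interpret \<psi>: group_hom ?L H \<psi>
    by unfold_locales
  have S: "S \<subseteq> carrier ?L"
    using gen by (simp add: topologically_generates_def)
  have "\<phi> g \<in> generate H (\<psi> ` S)" if g: "g \<in> carrier \<Gamma>" for g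
  proof -
    let ?\<eta> = "coset_family \<Gamma> \<N> g"
    interpret \<eta>: group_hom \<Gamma> ?L "coset_family \<Gamma> \<N>"
      by (rule coset_family_group_hom) (fact assms)+
    \<comment> \<open>The families that agree with \<open>?\<eta>\<close> at \<open>?K\<close> form
      an open neighbourhood of it, so one of them, \<open>w\<close>, lies in the dense subgroup
      generated by \<open>S\<close>.\<close>
    have "?K #>\<^bsub>\<Gamma>\<^esub> g \<in> carrier (\<Gamma> Mod ?K)"
      using g by (auto simp: FactGroup_def RCOSETS_def)
    then have "openin (quotient_limit_topology \<Gamma> \<N>) {f \<in> carrier ?L. f ?K \<in> {?K #>\<^bsub>\<Gamma>\<^esub> g}}"
      using assms(4) by (intro openin_quotient_limit_topology_eval) auto
    moreover have "?\<eta> \<in> {f \<in> carrier ?L. f ?K \<in> {?K #>\<^bsub>\<Gamma>\<^esub> g}}"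
      using g assms(4) by (simp add: coset_family_def[of \<Gamma> \<N> g])
         (metis coset_family_def \<eta>.hom_closed)
    moreover have "?\<eta> \<in> Abstract_Topology.closure_of (quotient_limit_topology \<Gamma> \<N>) (generate ?L S)"
      using gen \<eta>.hom_closed[OF g] by (simp add: topologically_generates_def)
    ultimately have "\<exists>w. w \<in> generate ?L S \<and> w \<in> {f \<in> carrier ?L. f ?K \<in> {?K #>\<^bsub>\<Gamma>\<^esub> g}}"
      by (simp only: in_closure_of)
    then obtain w where w: "w \<in> generate ?L S" "w ?K = ?K #>\<^bsub>\<Gamma>\<^esub> g"
      by (elim exE conjE CollectE singletonE)
    have "\<phi> x = \<phi> g" if "x \<in> ?K #>\<^bsub>\<Gamma>\<^esub> g" for x
    proof -
      from that obtain k where "k \<in> carrier \<Gamma>" "\<phi> k = \<one>\<^bsub>H\<^esub>" "x = k \<otimes>\<^bsub>\<Gamma>\<^esub> g"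
        unfolding r_coset_def kernel_def by blast
      then show ?thesis using g by simp
    qed
    moreover have "g \<in> ?K #>\<^bsub>\<Gamma>\<^esub> g"
      using \<phi>.G.rcos_self[OF g \<phi>.subgroup_kernel] .
    ultimately have "\<phi> ` (?K #>\<^bsub>\<Gamma>\<^esub> g) = {\<phi> g}"
      by blast
    then have "\<psi> w = \<phi> g"
      using w(2) by (simp add: \<psi>_def)
    then show ?thesis
      using w(1) \<psi>.generate_img[OF S] by (metis imageI)
  qed
  with S show ?thesis
    by (intro that[of \<psi>] image_subsetI) (auto intro: \<psi>.hom_closed)
qed

text \<open>The image of \<open>\<Gamma>\<close> is dense: a basic open set constrains finitely many
  coordinates, and these are all determined by the coordinate at the intersection of the subgroups
  involved. A representative of that one coset matches \<open>f\<close> at all of them.\<close>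

lemma topologically_generates_coset_family:
  assumes "group \<Gamma>" "\<And>N. N \<in> \<N> \<Longrightarrow> N \<lhd> \<Gamma>" "\<N> \<noteq> {}"
    and Int: "\<And>M N. M \<in> \<N> \<Longrightarrow> N \<in> \<N> \<Longrightarrow> M \<inter> N \<in> \<N>"
    and Y: "Y \<subseteq> carrier \<Gamma>" "generate \<Gamma> Y = carrier \<Gamma>"
  shows "topologically_generates (quotient_limit \<Gamma> \<N>) (quotient_limit_topology \<Gamma> \<N>)
    (coset_family \<Gamma> \<N> ` Y)"
proof -
  let ?L = "quotient_limit \<Gamma> \<N>" and ?T = "quotient_limit_topology \<Gamma> \<N>"
  interpret group \<Gamma> by fact
  interpret \<eta>: group_hom \<Gamma> ?L "coset_family \<Gamma> \<N>"
    by (rule coset_family_group_hom) (fact assms)+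
  have gen: "generate ?L (coset_family \<Gamma> \<N> ` Y) = coset_family \<Gamma> \<N> ` carrier \<Gamma>"
    using \<eta>.generate_img[OF Y(1)] Y(2) by simp
  have "f \<in> Abstract_Topology.closure_of ?T (coset_family \<Gamma> \<N> ` carrier \<Gamma>)" if f: "f \<in> carrier ?L" for f
    unfolding in_closure_of
  proof (intro conjI allI impI)
    show "f \<in> topspace ?T"
      using f by (simp add: topspace_quotient_limit_topology)
    fix T assume T: "f \<in> T \<and> openin ?T T"
    then obtain T' where T': "openin (product_topology (\<lambda>N. discrete_topology (carrier (\<Gamma> Mod N))) \<N>) T'"
      "T = T' \<inter> carrier ?L"
      unfolding quotient_limit_topology_def openin_subtopology by blast
    then obtain U where U: "finite {N \<in> \<N>. U N \<noteq> carrier (\<Gamma> Mod N)}"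
      "f \<in> Pi\<^sub>E \<N> U" "Pi\<^sub>E \<N> U \<subseteq> T'" "\<And>N. N \<in> \<N> \<Longrightarrow> U N \<subseteq> carrier (\<Gamma> Mod N)"
      using T unfolding openin_product_topology_alt by fastforce
    obtain N0 where N0: "N0 \<in> \<N>" using assms(3) by blast
    \<comment> \<open>Adding \<open>N0\<close> keeps \<open>F\<close> nonempty when no coordinate is
      constrained; otherwise \<open>\<Inter>F\<close> would be the whole type.\<close>
    define F where "F = insert N0 {N \<in> \<N>. U N \<noteq> carrier (\<Gamma> Mod N)}"
    have F: "finite F" "F \<noteq> {}" "F \<subseteq> \<N>"
      using U(1) N0 by (auto simp: F_def)
    have D: "\<Inter>F \<in> \<N>"
      using F by (induction rule: finite_ne_induct) (auto intro: Int)
    then have "f (\<Inter>F) \<in> carrier (\<Gamma> Mod \<Inter>F)"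
      using f by (auto simp: quotient_limit_def)
    then obtain g where g: "g \<in> carrier \<Gamma>" "f (\<Inter>F) = \<Inter>F #>\<^bsub>\<Gamma>\<^esub> g"
      by (auto simp: FactGroup_def RCOSETS_def)
    have "N #>\<^bsub>\<Gamma>\<^esub> g = f N" if N: "N \<in> F" for N
    proof -
      have "N <#>\<^bsub>\<Gamma>\<^esub> f (\<Inter>F) = f N"
        using f D N F(3) Inter_lower[OF N] by (simp add: quotient_limit_def subset_iff)
      then show ?thesis
        using subset_set_mult_rcoset[OF assms(2) assms(2) _ g(1), of "\<Inter>F" N] g D N F by auto
    qed
    \<comment> \<open>For \<open>N\<close> in \<open>\<N>\<close> outside \<open>F\<close> the set
      \<open>U N\<close> is the whole quotient, so any coset of \<open>N\<close> will do.\<close>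
    moreover have "N #>\<^bsub>\<Gamma>\<^esub> g \<in> carrier (\<Gamma> Mod N)" for N
      using g by (auto simp: FactGroup_def RCOSETS_def)
    ultimately have "coset_family \<Gamma> \<N> g \<in> Pi\<^sub>E \<N> U"
      using U(2) by (auto simp: coset_family_def F_def PiE_iff) metis
    then show "\<exists>y. y \<in> coset_family \<Gamma> \<N> ` carrier \<Gamma> \<and> y \<in> T"
      using U(3) T'(2) g(1) \<eta>.hom_closed by blast
  qed
  moreover have "Abstract_Topology.closure_of ?T Z \<subseteq> carrier ?L" for Z
    using closure_of_subset_topspace[of ?T Z] by (simp add: topspace_quotient_limit_topology)
  ultimately show ?thesis
    using Y(1) \<eta>.hom_closed unfolding topologically_generates_def gen by blast
qed

section \<open>Free products of cyclic groups\<close>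

text \<open>A letter is a power of the chosen generator of its factor, and the class of a word is
  the product of the classes of its letters.\<close>

lemma free_product_generate:
  assumes grp: "\<And>i. i \<in> I \<Longrightarrow> group (G i)"
    and x: "\<And>i. i \<in> I \<Longrightarrow> x i \<in> carrier (G i)"
    and cyc: "\<And>i. i \<in> I \<Longrightarrow> carrier (G i) = range (\<lambda>k::int. x i [^]\<^bsub>G i\<^esub> k)"
  shows "generate (free_product I G) ((\<lambda>i. free_product_inj I G i (x i)) ` I)
    = carrier (free_product I G)"
proof -
  let ?F = "free_product I G" and ?Y = "(\<lambda>i. free_product_inj I G i (x i)) ` I"
  interpret F: group ?F by (rule group_free_product[OF grp])
  have inj: "group_hom (G i) ?F (free_product_inj I G i)" if "i \<in> I" for i
    using that grp free_product_inj_hom[of I G i, OF grp] F.is_group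
    by (simp add: group_hom_def group_hom_axioms_def)
  have Y: "?Y \<subseteq> carrier ?F"
    using group_hom.hom_closed[OF inj] x by blast
  have sub: "subgroup (generate ?F ?Y) ?F"
    by (rule F.generate_is_subgroup[OF Y])
  have letter: "free_product_rel I G `` {[(i, y)]} \<in> generate ?F ?Y"
    if i: "i \<in> I" and y: "y \<in> carrier (G i)" for i y
  proof -
    obtain k :: int where "y = x i [^]\<^bsub>G i\<^esub> k"
      using y unfolding cyc[OF i] by blast
    then have "free_product_inj I G i y = free_product_inj I G i (x i) [^]\<^bsub>?F\<^esub> k"
      using group_hom.hom_int_pow[OF inj x] i by simp
    moreover have "free_product_inj I G i (x i) \<in> generate ?F ?Y"
      using i by (intro generate.incl) blast
    ultimately show ?thesis
      using F.subgroup_int_pow_closed[OF sub] by (simp add: free_product_inj_def)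
  qed
  have word: "free_product_rel I G `` {w} \<in> generate ?F ?Y" if "w \<in> free_product_words I G" for w
    using that
  proof (induction w)
    case Nil
    show ?case
      using subgroup.one_closed[OF sub] by (simp add: free_product_one[OF grp])
  next
    case (Cons a w)
    obtain i y where a: "a = (i, y)" by (cases a)
    have iy: "i \<in> I" "y \<in> carrier (G i)" "w \<in> free_product_words I G"
      using Cons.prems a by (auto simp: free_product_words_def)
    then have "[(i, y)] \<in> free_product_words I G"
      by (simp add: free_product_words_def)
    then have "free_product_rel I G `` {a # w}
        = free_product_rel I G `` {[(i, y)]} \<otimes>\<^bsub>?F\<^esub> free_product_rel I G `` {w}"
      using free_product_mult[of I G "[(i, y)]" w, OF grp] iy a by simp
    then show ?case
      using subgroup.m_closed[OF sub letter[OF iy(1,2)] Cons.IH[OF iy(3)]] by simp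
  qed
  have "carrier ?F \<subseteq> generate ?F ?Y"
  proof
    fix C assume C: "C \<in> carrier ?F"
    obtain w where "w \<in> free_product_words I G" "C = free_product_rel I G `` {w}"
      by (rule free_product_carrierE[OF grp C], assumption, rule that)
    then show "C \<in> generate ?F ?Y"
      using word by simp
  qed
  then show ?thesis
    using F.generate_incl[OF Y] by blast
qed

text \<open>The map takes the \<open>k\<close>-th power of \<open>x\<close> to the
  \<open>k\<close>-th power of \<open>h\<close>. Two exponents of the same element differ by a
  multiple of the order of \<open>x\<close>, which the order of \<open>h\<close> divides, so
  choosing an exponent by \<open>SOME\<close> does no harm.\<close>

lemma cyclic_group_hom_exists:
  assumes "group G" "x \<in> carrier G" "carrier G = range (\<lambda>k::int. x [^]\<^bsub>G\<^esub> k)"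
    and "group H" "h \<in> carrier H" "h [^]\<^bsub>H\<^esub> group.ord G x = \<one>\<^bsub>H\<^esub>"
  shows "\<exists>\<theta>\<in>hom G H. \<theta> x = h"
proof -
  interpret G: group G by fact
  interpret H: group H by fact
  define \<theta> where "\<theta> = (\<lambda>y. h [^]\<^bsub>H\<^esub> (SOME k::int. y = x [^]\<^bsub>G\<^esub> k))"
  have \<theta>: "\<theta> (x [^]\<^bsub>G\<^esub> k) = h [^]\<^bsub>H\<^esub> k" for k :: int
  proof -
    define l where "l = (SOME l::int. x [^]\<^bsub>G\<^esub> k = x [^]\<^bsub>G\<^esub> l)"
    have "x [^]\<^bsub>G\<^esub> k = x [^]\<^bsub>G\<^esub> l"
      unfolding l_def by (rule someI[of _ k]) simp
    then have "int (G.ord x) dvd l - k"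
      using G.int_pow_eq[OF assms(2)] by simp
    moreover have "int (H.ord h) dvd int (G.ord x)"
      using H.pow_eq_id[OF assms(5)] assms(6) by simp
    ultimately have "h [^]\<^bsub>H\<^esub> k = h [^]\<^bsub>H\<^esub> l"
      using H.int_pow_eq[OF assms(5)] dvd_trans by blast
    then show ?thesis
      by (simp add: \<theta>_def l_def)
  qed
  have "\<theta> \<in> hom G H"
  proof (rule homI)
    fix y z assume "y \<in> carrier G" "z \<in> carrier G"
    then obtain k l :: int where "y = x [^]\<^bsub>G\<^esub> k" "z = x [^]\<^bsub>G\<^esub> l"
      using assms(3) by blast
    then show "\<theta> y \<in> carrier H" "\<theta> (y \<otimes>\<^bsub>G\<^esub> z) = \<theta> y \<otimes>\<^bsub>H\<^esub> \<theta> z"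
      using assms(2,5) by (simp_all add: \<theta> G.int_pow_mult[symmetric] H.int_pow_mult)
  qed
  moreover have "\<theta> x = h"
    using \<theta>[of 1] assms(2,5) by (simp add: G.int_pow_1 H.int_pow_1)
  ultimately show ?thesis by blast
qed

section \<open>Affine groups\<close>

text \<open>Scalars form a whole field, so that spans and dimension are available, whereas
  \<open>V\<close> is only an additive subgroup stable under the multiplicative group
  \<open>A\<close>. This leaves room for a finite group of affine maps over an infinite
  field.\<close>

locale affine_maps = vector_space scale
  for scale :: "'k::field \<Rightarrow> 'v::ab_group_add \<Rightarrow> 'v" (infixr \<open>*s\<close> 75) +
  fixes V :: "'v set" and A :: "'k set"
  assumes zero_V: "0 \<in> V"
    and add_V: "\<lbrakk>v \<in> V; w \<in> V\<rbrakk> \<Longrightarrow> v + w \<in> V"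
    and uminus_V: "v \<in> V \<Longrightarrow> - v \<in> V"
    and scale_V: "\<lbrakk>a \<in> A; v \<in> V\<rbrakk> \<Longrightarrow> a *s v \<in> V"
    and one_A: "1 \<in> A"
    and mult_A: "\<lbrakk>a \<in> A; b \<in> A\<rbrakk> \<Longrightarrow> a * b \<in> A"
    and inverse_A: "a \<in> A \<Longrightarrow> inverse a \<in> A"
    and nonzero_A: "0 \<notin> A"
begin

text \<open>The pair \<open>(v, a)\<close> stands for the map \<open>w \<mapsto> v + a w\<close>.\<close>

definition affine_group :: "('v \<times> 'k) monoid"
  where "affine_group = \<lparr>carrier = V \<times> A,
    monoid.mult = (\<lambda>x y. (fst x + snd x *s fst y, snd x * snd y)), one = (0, 1)\<rparr>"

lemma affine_group_simps [simp]:
  "carrier affine_group = V \<times> A"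
  "x \<otimes>\<^bsub>affine_group\<^esub> y = (fst x + snd x *s fst y, snd x * snd y)"
  "\<one>\<^bsub>affine_group\<^esub> = (0, 1)"
  by (simp_all add: affine_group_def)

lemma affine_group_left_inverse:
  assumes "a \<in> A"
  shows "(- (inverse a *s v), inverse a) \<otimes>\<^bsub>affine_group\<^esub> (v, a) = \<one>\<^bsub>affine_group\<^esub>"
proof -
  have "a \<noteq> 0"
    using assms nonzero_A by blast
  then show ?thesis by simp
qed

lemma group_affine_group: "group affine_group"
proof (rule groupI)
  fix x assume "x \<in> carrier affine_group"
  then show "\<exists>y\<in>carrier affine_group. y \<otimes>\<^bsub>affine_group\<^esub> x = \<one>\<^bsub>affine_group\<^esub>"
    using affine_group_left_inverse uminus_V scale_V inverse_A
    by (intro bexI[of _ "(- (inverse (snd x) *s fst x), inverse (snd x))"]) auto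
qed (auto simp: zero_V add_V scale_V one_A mult_A scale_right_distrib)

lemma affine_group_inv:
  assumes "v \<in> V" "a \<in> A"
  shows "inv\<^bsub>affine_group\<^esub> (v, a) = (- (inverse a *s v), inverse a)"
proof -
  interpret group affine_group by (rule group_affine_group)
  show ?thesis
    using inv_equality[OF affine_group_left_inverse] assms uminus_V scale_V inverse_A by simp
qed

text \<open>When the geometric sum vanishes, so does \<open>a ^ k - 1\<close>, and the power is
  trivial whatever \<open>v\<close> is.\<close>

lemma affine_group_pow: "(v, a) [^]\<^bsub>affine_group\<^esub> (k::nat) = ((\<Sum>j<k. a ^ j) *s v, a ^ k)"
  by (induction k) (simp_all add: nat_pow_def scale_left_distrib)

text \<open>Products and inverses only add, negate and rescale translation parts, so these stay in
  the span over the full field. This turns a count of generators into a bound on dimension.\<close>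

lemma affine_group_generate_span:
  assumes "S \<subseteq> V \<times> A" "x \<in> generate affine_group S"
  shows "fst x \<in> span (fst ` S)"
  using assms(2)
proof (induction rule: generate.induct)
  case one
  then show ?case by (simp add: span_zero)
next
  case (incl h)
  then show ?case by (simp add: span_base)
next
  case (inv h)
  then have "inv\<^bsub>affine_group\<^esub> h = (- (inverse (snd h) *s fst h), inverse (snd h))"
    using affine_group_inv[of "fst h" "snd h"] assms(1) by auto
  then show ?case
    using inv by (simp add: span_neg span_scale span_base)
next
  case (eng h1 h2)
  then show ?case by (simp add: span_add span_scale)
qed

text \<open>Taking linear parts maps onto the abelian group \<open>A\<close>, and the kernel
  consists of the translations, which commute as well.\<close>

lemma solvable_affine_group: "solvable affine_group"
proof -
  define T where "T = \<lparr>carrier = V, monoid.mult = (+), one = 0 :: 'v\<rparr>"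
  define D where "D = \<lparr>carrier = A, monoid.mult = (*), one = 1 :: 'k\<rparr>"
  have T: "comm_group T"
    using uminus_V
    by (intro comm_groupI) (auto simp: T_def zero_V add_V ac_simps intro: bexI[of _ "- x" for x])
  have "a * inverse a = 1" if "a \<in> A" for a
    using that nonzero_A by (metis right_inverse)
  then have D: "comm_group D"
    using inverse_A
    by (intro comm_groupI) (auto simp: D_def one_A mult_A ac_simps intro!: bexI[of _ "inverse x" for x])
  show ?thesis
  proof (rule solvable_condition)
    show "group_hom T affine_group (\<lambda>v. (v, 1))"
      using T group_affine_group
      by (auto simp: group_hom_def group_hom_axioms_def hom_def comm_group_def T_def one_A)
    show "group_hom affine_group D snd"
      using D group_affine_group
      by (auto simp: group_hom_def group_hom_axioms_def hom_def comm_group_def D_def)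
    show "snd ` carrier affine_group = carrier D"
      using zero_V by (force simp: D_def)
    show "kernel affine_group D snd \<subseteq> (\<lambda>v. (v, 1)) ` carrier T"
      by (auto simp: kernel_def D_def T_def)
  qed (simp_all add: T D comm_group_imp_solvable)
qed

end

section \<open>Roots of unity in characteristic two\<close>

text \<open>Algebraic closedness supplies the roots \<open>\<zeta>\<close>; positive characteristic
  makes the additive group generated by finitely many elements finite.\<close>

type_synonym F2bar = "bit alg_closure"

text \<open>The polynomial has positive degree \<open>m - 1\<close>; here the nontriviality of the
  cyclic factors enters.\<close>

lemma exists_geometric_sum_root:
  assumes "2 \<le> m"
  shows "\<exists>\<zeta>::'a::alg_closed_field. (\<Sum>j<m. \<zeta> ^ j) = 0"
proof -
  have "\<exists>\<zeta>::'a. (\<Sum>j\<le>m - 1. 1 * \<zeta> ^ j) = 0"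
    using assms by (intro alg_closed[of "m - 1" "\<lambda>_. 1"]) auto
  moreover have "{..m - 1} = {..<m}"
    using assms by auto
  ultimately show ?thesis by simp
qed

lemma geometric_sum_root_power:
  fixes \<zeta> :: "'a::comm_ring_1"
  assumes "(\<Sum>j<m. \<zeta> ^ j) = 0"
  shows "\<zeta> ^ m = 1"
  using power_diff_1_eq[of \<zeta> m] assms by simp

lemma finite_roots_of_unity:
  assumes "0 < m"
  shows "finite {a::'a::idom. a ^ m = 1}"
proof -
  let ?p = "Polynomial.monom 1 m - 1 :: 'a poly"
  have "poly.coeff ?p m = 1"
    using assms by (simp add: coeff_1)
  then have "?p \<noteq> 0" by (metis poly_0_coeff_0 coeff_0 zero_neq_one)
  then have "finite {a. poly ?p a = 0}" by (rule poly_roots_finite)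
  then show ?thesis by (simp add: poly_monom)
qed

text \<open>For finite \<open>A\<close>, the span of \<open>A\<close> over the field with two
  elements. It replaces the infinite field as the set of allowed coordinates of translation
  vectors.\<close>

definition F2_combinations :: "F2bar set \<Rightarrow> F2bar set"
  where "F2_combinations A = range (\<lambda>c. \<Sum>a\<in>A. to_ac (c a) * a)"

lemma F2_combinationsI: "(\<Sum>a\<in>A. to_ac (c a) * a) \<in> F2_combinations A"
  by (simp add: F2_combinations_def)

lemma finite_F2_combinations: "finite A \<Longrightarrow> finite (F2_combinations A)"
proof -
  assume A: "finite A"
  \<comment> \<open>Coefficients outside \<open>A\<close> do not affect the sum, so functions from
    \<open>A\<close> to the two-element field suffice.\<close>
  have "F2_combinations A \<subseteq> (\<lambda>c. \<Sum>a\<in>A. to_ac (c a) * a) ` (A \<rightarrow>\<^sub>E UNIV)"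
  proof
    fix x assume "x \<in> F2_combinations A"
    then obtain c where "x = (\<Sum>a\<in>A. to_ac (c a) * a)"
      by (auto simp: F2_combinations_def)
    then show "x \<in> (\<lambda>c. \<Sum>a\<in>A. to_ac (c a) * a) ` (A \<rightarrow>\<^sub>E UNIV)"
      by (intro image_eqI[where x = "restrict c A"]) simp_all
  qed
  moreover have "(UNIV :: bit set) = {0, 1}"
    using bit_not_zero_iff by blast
  then have "finite (UNIV :: bit set)"
    by (metis finite.emptyI finite.insertI)
  then have "finite (A \<rightarrow>\<^sub>E (UNIV :: bit set))"
    using A by (intro finite_PiE)
  ultimately show ?thesis
    by (rule finite_subset[OF _ finite_imageI])
qed

lemma F2_combinations_add:
  assumes "x \<in> F2_combinations A" "y \<in> F2_combinations A"
  shows "x + y \<in> F2_combinations A"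
proof -
  obtain c d where "x = (\<Sum>a\<in>A. to_ac (c a) * a)" "y = (\<Sum>a\<in>A. to_ac (d a) * a)"
    using assms by (auto simp: F2_combinations_def)
  then have "x + y = (\<Sum>a\<in>A. to_ac (c a + d a) * a)"
    by (simp only: to_ac_add sum.distrib distrib_right)
  then show ?thesis using F2_combinationsI[of "\<lambda>a. c a + d a" A] by (simp only:)
qed

lemma F2_combinations_uminus:
  assumes "x \<in> F2_combinations A"
  shows "- x \<in> F2_combinations A"
proof -
  obtain c where "x = (\<Sum>a\<in>A. to_ac (c a) * a)"
    using assms by (auto simp: F2_combinations_def)
  then have "- x = (\<Sum>a\<in>A. to_ac (- c a) * a)"
    by (simp only: to_ac_minus sum_negf mult_minus_left)
  then show ?thesis using F2_combinationsI[of "\<lambda>a. - c a" A] by (simp only:)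
qed

lemma F2_combinations_superset:
  assumes "finite A" "b \<in> A"
  shows "b \<in> F2_combinations A"
proof -
  have "(\<Sum>a\<in>A. to_ac (if a = b then 1 else 0) * a) = (\<Sum>a\<in>A. if a = b then a else 0)"
    by (intro sum.cong) auto
  also have "\<dots> = b" using assms by simp
  finally show ?thesis
    using F2_combinationsI[of "\<lambda>a. if a = b then 1 else 0" A] by (simp only:)
qed

text \<open>Multiplication by \<open>b\<close> permutes \<open>A\<close>, so it merely moves the
  coefficients along \<open>a \<mapsto> a / b\<close>.\<close>

lemma F2_combinations_mult:
  assumes "\<And>a. a \<in> A \<Longrightarrow> b * a \<in> A" "\<And>a. a \<in> A \<Longrightarrow> a / b \<in> A" "b \<noteq> 0"
    and "x \<in> F2_combinations A"
  shows "b * x \<in> F2_combinations A"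
proof -
  obtain c where "x = (\<Sum>a\<in>A. to_ac (c a) * a)"
    using assms(4) by (auto simp: F2_combinations_def)
  then have "b * x = (\<Sum>a\<in>A. to_ac (c a) * (b * a))"
    by (simp add: sum_distrib_left mult_ac)
  also have "\<dots> = (\<Sum>a\<in>A. to_ac (c (a / b)) * a)"
    by (rule sum.reindex_bij_witness[where i = "\<lambda>a. a / b" and j = "\<lambda>a. b * a"])
      (use assms in auto)
  finally show ?thesis
    using F2_combinationsI[of "\<lambda>a. c (a / b)" A] by (simp only:)
qed

section \<open>A finite solvable quotient of large rank\<close>

lemma vector_space_pointwise: "vector_space (\<lambda>(c::'k::field) (f::'i \<Rightarrow> 'k) i. c * f i)"
  by unfold_locales (auto simp: fun_eq_iff algebra_simps)

text \<open>The functions vanishing at \<open>i\<close> form a subspace that contains every other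
  unit function but not the one at \<open>i\<close>.\<close>

lemma independent_unit_functions:
  "module.independent (\<lambda>(c::'k::field) (f::'i \<Rightarrow> 'k) i. c * f i)
    ((\<lambda>i j. if j = i then 1 else 0) ` I)"
proof -
  interpret vector_space "\<lambda>(c::'k) (f::'i \<Rightarrow> 'k) i. c * f i"
    by (rule vector_space_pointwise)
  let ?e = "\<lambda>i j::'i. if j = i then 1 else (0::'k)"
  have "\<not> dependent (?e ` I)"
  proof
    assume "dependent (?e ` I)"
    then obtain i where "i \<in> I" and sp: "?e i \<in> span (?e ` I - {?e i})"
      unfolding dependent_def by blast
    have "subspace {f :: 'i \<Rightarrow> 'k. f i = 0}"
      by (auto simp: subspace_def)
    moreover have "?e ` I - {?e i} \<subseteq> {f. f i = 0}"
      by auto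
    ultimately have "?e i \<in> {f. f i = 0}"
      using sp span_minimal by blast
    then show False by simp
  qed
  then show ?thesis .
qed

text \<open>The bound concerns subsets of all of \<open>H\<close> whose generated subgroup contains
  the image of \<open>\<phi>\<close>, so \<open>H\<close> can be the full affine group rather than
  that image.\<close>

lemma free_product_cyclic_solvable_image:
  fixes G :: "'i \<Rightarrow> ('a, 'b) monoid_scheme"
  assumes "finite I" and grp: "\<And>i. i \<in> I \<Longrightarrow> group (G i)"
    and fin: "\<And>i. i \<in> I \<Longrightarrow> finite (carrier (G i))"
    and x: "\<And>i. i \<in> I \<Longrightarrow> x i \<in> carrier (G i)"
    and cyc: "\<And>i. i \<in> I \<Longrightarrow> carrier (G i) = range (\<lambda>k::int. x i [^]\<^bsub>G i\<^esub> k)"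
    and nontriv: "\<And>i. i \<in> I \<Longrightarrow> \<not> trivial_group (G i)"
  obtains H :: "(('i \<Rightarrow> F2bar) \<times> F2bar) monoid" and \<phi>
  where "group_hom (free_product I G) H \<phi>" "finite (carrier H)" "solvable H"
    "\<And>S. \<lbrakk>finite S; S \<subseteq> carrier H; \<phi> ` carrier (free_product I G) \<subseteq> generate H S\<rbrakk>
      \<Longrightarrow> card I \<le> card S"
proof -
  define m where "m = (\<lambda>i. group.ord (G i) (x i))"
  have m: "2 \<le> m i" if "i \<in> I" for i
  proof -
    interpret group "G i" using grp that .
    have "m i \<noteq> 1"
    proof
      assume "m i = 1"
      then have "x i = \<one>\<^bsub>G i\<^esub>"
        using ord_eq_1 x[OF that] by (simp add: m_def)
      then have "carrier (G i) = {\<one>\<^bsub>G i\<^esub>}"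
        using cyc[OF that] by auto
      then show False
        using nontriv[OF that] by (simp add: trivial_group_def is_group)
    qed
    moreover have "1 \<le> m i"
      unfolding m_def using ord_ge_1 fin x that by simp
    ultimately show ?thesis by simp
  qed
  have "\<forall>i\<in>I. \<exists>z::F2bar. (\<Sum>j<m i. z ^ j) = 0"
    using exists_geometric_sum_root m by blast
  then obtain \<zeta> :: "'i \<Rightarrow> F2bar" where \<zeta>: "\<And>i. i \<in> I \<Longrightarrow> (\<Sum>j<m i. \<zeta> i ^ j) = 0"
    by metis
  \<comment> \<open>A common multiple of the orders, so that every \<open>\<zeta> i\<close> lies in
    the one finite group \<open>A\<close> of roots of unity.\<close>
  define M where "M = (\<Prod>i\<in>I. m i)"
  have M: "0 < M"
    unfolding M_def using m by (intro prod_pos) fastforce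
  define A where "A = {a::F2bar. a ^ M = 1}"
  \<comment> \<open>Fixing the value 0 outside \<open>I\<close> keeps \<open>V\<close> finite even
    if the index type is infinite.\<close>
  define V where "V = {f :: 'i \<Rightarrow> F2bar. \<forall>i. (i \<in> I \<longrightarrow> f i \<in> F2_combinations A) \<and> (i \<notin> I \<longrightarrow> f i = 0)}"
  have A: "finite A" "1 \<in> A" "0 \<notin> A"
    using finite_roots_of_unity[OF M] M by (simp_all add: A_def zero_power)
  have Am: "a * b \<in> A" if "a \<in> A" "b \<in> A" for a b
    using that by (simp add: A_def power_mult_distrib)
  have Ai: "inverse a \<in> A" if "a \<in> A" for a
    using that by (simp add: A_def power_inverse)
  have Ad: "a / b \<in> A" if "a \<in> A" "b \<in> A" for a b
    using Am Ai that by (simp add: divide_inverse)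
  have R0: "0 \<in> F2_combinations A"
    using F2_combinations_add[OF F2_combinations_superset F2_combinations_uminus[OF F2_combinations_superset]]
      A by (metis add.right_inverse)
  have Rm: "a * r \<in> F2_combinations A" if "a \<in> A" "r \<in> F2_combinations A" for a r
    by (rule F2_combinations_mult) (use that Am Ad A in auto)
  interpret vector_space "\<lambda>(c::F2bar) (f::'i \<Rightarrow> F2bar) i. c * f i"
    by (rule vector_space_pointwise)
  interpret affine_maps "\<lambda>(c::F2bar) (f::'i \<Rightarrow> F2bar) i. c * f i" V A
    by unfold_locales
      (auto simp: V_def R0 F2_combinations_add F2_combinations_uminus Rm A Am Ai)
  define e where "e = (\<lambda>i j::'i. if j = i then 1 else (0::F2bar))"
  have eV: "e i \<in> V" if "i \<in> I" for i
    using that F2_combinations_superset[OF A(1,2)] R0 by (auto simp: V_def e_def)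
  have \<zeta>A: "\<zeta> i \<in> A" if "i \<in> I" for i
  proof -
    have "m i dvd M"
      unfolding M_def using that assms(1) by (rule dvd_prodI[rotated])
    then show ?thesis
      using geometric_sum_root_power[OF \<zeta>[OF that]] by (auto simp: A_def dvd_def power_mult)
  qed
  have "\<exists>\<theta>\<in>hom (G i) affine_group. \<theta> (x i) = (e i, \<zeta> i)" if "i \<in> I" for i
  proof (rule cyclic_group_hom_exists)
    \<comment> \<open>The geometric sum at \<open>\<zeta> i\<close> is 0, which kills the
      translation part and forces the linear part to be 1.\<close>
    have "(e i, \<zeta> i) [^]\<^bsub>affine_group\<^esub> m i = \<one>\<^bsub>affine_group\<^esub>"
      using \<zeta>[OF that] geometric_sum_root_power[OF \<zeta>[OF that]]
      by (simp add: affine_group_pow zero_fun_def)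
    then show "(e i, \<zeta> i) [^]\<^bsub>affine_group\<^esub> group.ord (G i) (x i) = \<one>\<^bsub>affine_group\<^esub>"
      by (simp only: m_def)
  qed (use that grp x cyc group_affine_group eV \<zeta>A in auto)
  then obtain \<theta> where \<theta>: "\<And>i. i \<in> I \<Longrightarrow> \<theta> i \<in> hom (G i) affine_group"
    "\<And>i. i \<in> I \<Longrightarrow> \<theta> i (x i) = (e i, \<zeta> i)"
    by metis
  obtain \<phi> where \<phi>: "\<phi> \<in> hom (free_product I G) affine_group"
    "\<And>i y. i \<in> I \<Longrightarrow> y \<in> carrier (G i) \<Longrightarrow> \<phi> (free_product_inj I G i y) = \<theta> i y"
    using free_product_universal[of I G affine_group \<theta>, OF grp group_affine_group \<theta>(1)] by blast
  show thesis
  proof (rule that)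
    show "group_hom (free_product I G) affine_group \<phi>"
      using \<phi>(1) group_affine_group group_free_product[of I G, OF grp]
      by (simp add: group_hom_def group_hom_axioms_def)
    have "finite V"
      unfolding V_def using finite_set_of_finite_funs[OF assms(1) finite_F2_combinations[OF A(1)]] .
    then show "finite (carrier affine_group)"
      using A(1) by simp
    show "solvable affine_group"
      by (rule solvable_affine_group)
    fix S
    assume S: "finite S" "S \<subseteq> carrier affine_group"
      "\<phi> ` carrier (free_product I G) \<subseteq> generate affine_group S"
    \<comment> \<open>\<open>e i\<close> is the translation part of the image of the generator
      \<open>x i\<close>.\<close>
    have "e i \<in> span (fst ` S)" if i: "i \<in> I" for i
    proof -
      have "free_product_inj I G i (x i) \<in> carrier (free_product I G)"
        using free_product_inj_hom[of I G i, OF grp i] x[OF i] by (auto simp: hom_def)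
      then have "(e i, \<zeta> i) \<in> generate affine_group S"
        using S(3) \<phi>(2)[OF i x[OF i]] \<theta>(2)[OF i] by (metis image_subset_iff)
      then show ?thesis
        using affine_group_generate_span[of S "(e i, \<zeta> i)"] S(2) by simp
    qed
    then have "card (e ` I) \<le> card (fst ` S)"
      using independent_span_bound[of "fst ` S" "e ` I"] S(1)
        independent_unit_functions[of I, where 'k = F2bar, folded e_def] by blast
    moreover have "inj_on e I"
      unfolding inj_on_def e_def by (metis zero_neq_one)
    ultimately show "card I \<le> card S"
      using card_image_le[OF S(1), of fst] by (simp add: card_image)
  qed
qed

section \<open>The minimal number of generators\<close>

text \<open>Common form of both completions: generators of \<open>\<Gamma>\<close> bound the number
  from above by density, and the rank condition on \<open>H\<close> bounds it from below.\<close>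

lemma min_top_generators_quotient_limit:
  assumes "group \<Gamma>" "\<And>N. N \<in> \<N> \<Longrightarrow> N \<lhd> \<Gamma>"
    and Int: "\<And>M N. M \<in> \<N> \<Longrightarrow> N \<in> \<N> \<Longrightarrow> M \<inter> N \<in> \<N>"
    and Y: "finite Y" "Y \<subseteq> carrier \<Gamma>" "generate \<Gamma> Y = carrier \<Gamma>" "card Y \<le> n"
    and \<phi>: "group_hom \<Gamma> H \<phi>" "kernel \<Gamma> H \<phi> \<in> \<N>"
    and rank: "\<And>S. \<lbrakk>finite S; S \<subseteq> carrier H; \<phi> ` carrier \<Gamma> \<subseteq> generate H S\<rbrakk> \<Longrightarrow> n \<le> card S"
  shows "min_top_generators (quotient_limit \<Gamma> \<N>) (quotient_limit_topology \<Gamma> \<N>) = enat n"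
  unfolding min_top_generators_def
proof (rule antisym)
  let ?D = "{enat (card S) | S. finite S \<and>
    topologically_generates (quotient_limit \<Gamma> \<N>) (quotient_limit_topology \<Gamma> \<N>) S}"
  have "topologically_generates (quotient_limit \<Gamma> \<N>) (quotient_limit_topology \<Gamma> \<N>)
      (coset_family \<Gamma> \<N> ` Y)"
  proof (rule topologically_generates_coset_family)
    show "\<N> \<noteq> {}"
      using \<phi>(2) by auto
  qed (fact assms(1) assms(2) Int Y(2) Y(3))+
  then have "enat (card (coset_family \<Gamma> \<N> ` Y)) \<in> ?D"
    using Y(1) by blast
  then have "Inf ?D \<le> enat (card (coset_family \<Gamma> \<N> ` Y))"
    by (rule Inf_lower)
  also have "\<dots> \<le> enat n"
    using order_trans[OF card_image_le[OF Y(1)] Y(4)] by simp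
  finally show "Inf ?D \<le> enat n" .
  show "enat n \<le> Inf ?D"
  proof (rule Inf_greatest)
    fix d assume "d \<in> ?D"
    then obtain S where S: "d = enat (card S)" "finite S"
      "topologically_generates (quotient_limit \<Gamma> \<N>) (quotient_limit_topology \<Gamma> \<N>) S"
      by blast
    obtain \<psi> where \<psi>: "\<psi> ` S \<subseteq> carrier H" "\<phi> ` carrier \<Gamma> \<subseteq> generate H (\<psi> ` S)"
      by (rule topologically_generates_quotient_image[OF assms(1,2) \<phi> S(3)], assumption, rule that)
    have "n \<le> card (\<psi> ` S)"
      by (rule rank[OF finite_imageI[OF S(2)] \<psi>])
    also have "\<dots> \<le> card S"
      by (rule card_image_le[OF S(2)])
    finally show "enat n \<le> d"
      using S(1) by simp
  qed
qed

theorem proposition8: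
  fixes n :: nat and G :: "nat \<Rightarrow> ('a, 'b) monoid_scheme"
  assumes "n \<ge> 1"
    and "\<And>i. i \<in> {1..n} \<Longrightarrow> group (G i)"
    and "\<And>i. i \<in> {1..n} \<Longrightarrow> finite (carrier (G i))"
    and "\<And>i. i \<in> {1..n} \<Longrightarrow> cyclic_group (G i)"
    and "\<And>i. i \<in> {1..n} \<Longrightarrow> \<not> trivial_group (G i)"
    and "\<Gamma> = free_product {1..n} G"
  shows "min_top_generators (prosolvable_completion \<Gamma>) (prosolvable_topology \<Gamma>) = enat n
    \<and> min_top_generators (profinite_completion \<Gamma>) (profinite_topology \<Gamma>) = enat n"
proof -
  have "\<exists>y\<in>carrier (G i). carrier (G i) = range (\<lambda>k::int. y [^]\<^bsub>G i\<^esub> k)" if "i \<in> {1..n}" for i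
    using group.cyclic_group[OF assms(2)[OF that]] assms(4)[OF that] by simp
  then obtain x where x: "\<And>i. i \<in> {1..n} \<Longrightarrow> x i \<in> carrier (G i)"
    "\<And>i. i \<in> {1..n} \<Longrightarrow> carrier (G i) = range (\<lambda>k::int. x i [^]\<^bsub>G i\<^esub> k)"
    by metis
  note image = free_product_cyclic_solvable_image[of "{1..n}" G x, OF finite_atLeastAtMost assms(2,3) x
      assms(5), folded assms(6), unfolded card_atLeastAtMost diff_Suc_1]
  obtain H :: "((nat \<Rightarrow> F2bar) \<times> F2bar) monoid" and \<phi>
    where H: "group_hom \<Gamma> H \<phi>" "finite (carrier H)" "solvable H"
    and rank: "\<And>S. \<lbrakk>finite S; S \<subseteq> carrier H; \<phi> ` carrier \<Gamma> \<subseteq> generate H S\<rbrakk> \<Longrightarrow> n \<le> card S"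
    by (rule image, assumption+, rule that)
  interpret group_hom \<Gamma> H \<phi> by fact
  \<comment> \<open>One generator from each factor.\<close>
  define Y where "Y = (\<lambda>i. free_product_inj {1..n} G i (x i)) ` {1..n}"
  have Y: "generate \<Gamma> Y = carrier \<Gamma>"
    using free_product_generate[of "{1..n}" G x, OF assms(2) x] by (simp add: assms(6) Y_def)
  have Y': "finite Y" "Y \<subseteq> carrier \<Gamma>" "card Y \<le> n"
    using generate.incl[of _ Y \<Gamma>] Y card_image_le[of "{1..n}" "\<lambda>i. free_product_inj {1..n} G i (x i)"]
    by (auto simp: Y_def)
  \<comment> \<open>Since \<open>H\<close> is both finite and solvable, the kernel of the same
    \<open>\<phi>\<close> belongs to either family of normal subgroups, so one homomorphism settles
    both completions.\<close>
  note eq = min_top_generators_quotient_limit[OF G.is_group _ _ Y'(1,2) Y Y'(3) H(1) _ rank]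
  have "min_top_generators (prosolvable_completion \<Gamma>) (prosolvable_topology \<Gamma>) = enat n"
    unfolding prosolvable_completion_def prosolvable_topology_def
    by (rule eq[OF _ G.finite_solvable_quotient_kernels_Int
          kernel_in_finite_solvable_quotient_kernels[OF H(2,3)]])
      (simp_all add: finite_solvable_quotient_kernels_def)
  moreover have "min_top_generators (profinite_completion \<Gamma>) (profinite_topology \<Gamma>) = enat n"
    unfolding profinite_completion_def profinite_topology_def
    by (rule eq[OF _ G.finite_quotient_kernels_Int kernel_in_finite_quotient_kernels[OF H(2)]])
      (simp_all add: finite_quotient_kernels_def)
  ultimately show ?thesis ..
qed

end
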